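(* Let $G=\langle a_1,\dots,a_n\rangle$ be the free group on the free generators $a_1,\dots,a_n$, let $H$ be a finitely generated free group, and let $\phi,\psi:G\to H$ be homomorphisms. If $\phi$ has remnant with $$|\mathrm{Rem}_\phi(a_i)|>|a_i\psi|$$ for all the generators $a_i$ of $G$, then $Eq(\phi,\psi)=\{1\}$.
   Context: Homomorphisms are written on the right: $g\phi$ is the image of $g$ under $\phi$. Elements of $H$ are identified with freely reduced words in a fixed free basis of $H$, and $|w|$ denotes the length of the reduced word $w$. The equalizer subgroup is $Eq(\phi,\psi)=\{g\in G\mid g\phi=g\psi\}\le G$. A homomorphism $\phi:G\to H$, where $G$ is free on $a_1,\dots,a_n$, has remnant if for each $1\le i\le n$ the reduced word $a_i\phi$ has a nontrivial subword (block of consecutive letters) which does not cancel in any of the products $(a_j\phi)^{\pm1}(a_i\phi)$ and $(a_i\phi)(a_j\phi)^{\pm1}$, $1\le j\le n$, except for $j=i$ with exponent $-1$. The maximal such noncancelling subword of $a_i\phi$ is called the remnant of $a_i$ and is denoted $\mathrm{Rem}_\phi(a_i)$. (Equivalently, $\mathrm{Rem}_\phi(a_i)$ is what remains of $a_i\phi$ after deleting the longest initial segment cancelling in one of the products $(a_j\phi)^{\pm1}(a_i\phi)$ and the longest terminal segment cancelling in one of the products $(a_i\phi)(a_j\phi)^{\pm1}$, the case $j=i$ with exponent $-1$ being excluded.) *)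

theory Defs
  imports "HOL-Algebra.Group" "HOL-Library.Sublist"
begin

text \<open>
  Words over the letters \<open>x\<close> and \<open>x\<close>-inverse are lists over \<open>'a \<times> bool\<close>: the letter
  \<open>(x, True)\<close> is the generator \<open>x\<close>, and \<open>(x, False)\<close> is its inverse.
\<close>

type_synonym 'a word = "('a \<times> bool) list"

definition inv_letter :: "'a \<times> bool \<Rightarrow> 'a \<times> bool" where
  "inv_letter l = (fst l, \<not> snd l)"

definition inv_word :: "'a word \<Rightarrow> 'a word" where
  "inv_word w = rev (map inv_letter w)"

definition reduced :: "'a word \<Rightarrow> bool" where
  "reduced w \<longleftrightarrow> successively (\<lambda>l m. m \<noteq> inv_letter l) w"

definition push_letter :: "'a \<times> bool \<Rightarrow> 'a word \<Rightarrow> 'a word" where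
  "push_letter l w = (case w of [] \<Rightarrow> [l] | m # w' \<Rightarrow> if m = inv_letter l then w' else l # w)"

definition reduce :: "'a word \<Rightarrow> 'a word" where
  "reduce w = foldr push_letter w []"

definition free_group :: "'a set \<Rightarrow> 'a word monoid" where
  "free_group X =
     \<lparr>carrier = {w. reduced w \<and> fst ` set w \<subseteq> X}, mult = (\<lambda>u v. reduce (u @ v)), one = []\<rparr>"

definition gen :: "'a \<Rightarrow> 'a word" where
  "gen x = [(x, True)]"

text \<open>
  For reduced \<open>u\<close> and \<open>v\<close>, \<open>cancelled u v\<close> is the number of letters of \<open>u\<close> (at its end),
  and equally of \<open>v\<close> (at its beginning), that cancel in the product of \<open>u\<close> and \<open>v\<close>;
  see \<open>mult_free_group_cancelled\<close> below.
\<close>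

definition cancelled :: "'a word \<Rightarrow> 'a word \<Rightarrow> nat" where
  "cancelled u v = length (longest_common_prefix (inv_word u) v)"

definition signed :: "bool \<Rightarrow> 'a word \<Rightarrow> 'a word" where
  "signed e w = (if e then w else inv_word w)"

text \<open>
  A block of consecutive letters of a word is given with its position, by a decomposition
  \<open>p @ r @ s\<close> of the word. None of the letters of \<open>r\<close> cancels in a product \<open>v (p @ r @ s)\<close> iff all
  cancelled letters lie in \<open>p\<close>, and in a product \<open>(p @ r @ s) v\<close> iff they all lie in \<open>s\<close>.
\<close>

definition noncancelling_block ::
  "'a set \<Rightarrow> ('a word \<Rightarrow> 'b word) \<Rightarrow> 'a \<Rightarrow> 'b word \<Rightarrow> 'b word \<Rightarrow> 'b word \<Rightarrow> bool" where
  "noncancelling_block X \<phi> i p r s \<longleftrightarrow>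
     \<phi> (gen i) = p @ r @ s \<and> r \<noteq> [] \<and>
     (\<forall>j\<in>X. \<forall>e. \<not> (j = i \<and> \<not> e) \<longrightarrow>
        cancelled (signed e (\<phi> (gen j))) (\<phi> (gen i)) \<le> length p \<and>
        cancelled (\<phi> (gen i)) (signed e (\<phi> (gen j))) \<le> length s)"

definition has_remnant :: "'a set \<Rightarrow> ('a word \<Rightarrow> 'b word) \<Rightarrow> bool" where
  "has_remnant X \<phi> \<longleftrightarrow> (\<forall>i\<in>X. \<exists>p r s. noncancelling_block X \<phi> i p r s)"

definition remnant :: "'a set \<Rightarrow> ('a word \<Rightarrow> 'b word) \<Rightarrow> 'a \<Rightarrow> 'b word" where
  "remnant X \<phi> i = (THE r. \<exists>p s. noncancelling_block X \<phi> i p r s \<and>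
     (\<forall>p' r' s'. noncancelling_block X \<phi> i p' r' s' \<longrightarrow> length r' \<le> length r))"

definition equalizer ::
  "('a, 'c) monoid_scheme \<Rightarrow> ('a \<Rightarrow> 'b) \<Rightarrow> ('a \<Rightarrow> 'b) \<Rightarrow> 'a set" where
  "equalizer G \<phi> \<psi> = {g \<in> carrier G. \<phi> g = \<psi> g}"

lemma inv_letter_inv_letter [simp]: "inv_letter (inv_letter l) = l"
  by (simp add: inv_letter_def)

lemma inv_letter_eq_iff [simp]: "inv_letter l = inv_letter m \<longleftrightarrow> l = m"
  by (metis inv_letter_inv_letter)

lemma inv_letter_neq [simp]: "inv_letter l \<noteq> l" "l \<noteq> inv_letter l"
  by (cases l; simp add: inv_letter_def)+

lemma inv_word_simps [simp]:
  "inv_word [] = []" "inv_word (l # w) = inv_word w @ [inv_letter l]"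
  "inv_word (u @ v) = inv_word v @ inv_word u" "inv_word (inv_word w) = w"
  "length (inv_word w) = length w"
  by (simp_all add: inv_word_def rev_map o_def)

lemma reduced_Nil [simp]: "reduced []"
  by (simp add: reduced_def)

lemma reduced_Cons: "reduced (l # w) \<longleftrightarrow> (w \<noteq> [] \<longrightarrow> hd w \<noteq> inv_letter l) \<and> reduced w"
  by (auto simp: reduced_def successively_Cons)

lemma reduced_append: "reduced (u @ v) \<longleftrightarrow>
  reduced u \<and> reduced v \<and> (u \<noteq> [] \<longrightarrow> v \<noteq> [] \<longrightarrow> hd v \<noteq> inv_letter (last u))"
  by (auto simp: reduced_def successively_append_iff)

lemma reduced_inv_word: "reduced w \<Longrightarrow> reduced (inv_word w)"
proof (induction w)
  case (Cons l w)
  then show ?case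
    by (cases w) (auto simp: reduced_append reduced_Cons)
qed simp

lemma reduced_push_letter: "reduced w \<Longrightarrow> reduced (push_letter l w)"
  by (auto simp: push_letter_def reduced_Cons split: list.split)

lemma push_letter_inv_letter:
  assumes "reduced w"
  shows "push_letter l (push_letter (inv_letter l) w) = w"
proof (cases w)
  case (Cons m w')
  then show ?thesis
    using assms by (cases w') (auto simp: push_letter_def reduced_Cons)
qed (simp add: push_letter_def)

lemma reduce_simps [simp]: "reduce [] = []" "reduce (l # w) = push_letter l (reduce w)"
  by (simp_all add: reduce_def)

lemma reduced_reduce [simp]: "reduced (reduce w)"
  by (induction w) (simp_all add: reduced_push_letter)

lemma push_letter_reduced: "reduced (l # w) \<Longrightarrow> push_letter l w = l # w"
  by (auto simp: push_letter_def reduced_Cons split: list.split)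

lemma reduce_reduced: "reduced w \<Longrightarrow> reduce w = w"
  by (induction w) (simp_all add: reduced_Cons push_letter_reduced)

lemma reduce_append_right: "reduce (u @ reduce v) = reduce (u @ v)"
  by (induction u) (simp_all add: reduce_reduced)

lemma reduce_push_letter_append:
  "reduce (push_letter l w @ v) = push_letter l (reduce (w @ v))"
proof (cases w)
  case (Cons m w')
  then show ?thesis
    using push_letter_inv_letter[of "reduce (w' @ v)" l] by (auto simp: push_letter_def[of l "m # w'"])
qed (simp add: push_letter_def[of l "[]"])

lemma reduce_append_left: "reduce (reduce u @ v) = reduce (u @ v)"
  by (induction u) (simp_all add: reduce_push_letter_append)

lemma reduce_inv_word_append: "reduce (inv_word w @ w) = []"
proof (induction w)
  case (Cons l w)
  have "reduce (inv_word w @ inv_letter l # l # w) = reduce (inv_word w @ reduce (inv_letter l # l # w))"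
    by (simp only: reduce_append_right)
  also have "reduce (inv_letter l # l # w) = reduce w"
    using push_letter_inv_letter[of "reduce w" "inv_letter l"] by simp
  finally show ?case
    using Cons by (simp add: reduce_append_right)
qed simp

lemma set_reduce: "set (reduce w) \<subseteq> set w"
proof (induction w)
  case (Cons l w)
  have "set (push_letter l (reduce w)) \<subseteq> insert l (set (reduce w))"
    by (auto simp: push_letter_def split: list.splits if_splits)
  then show ?case
    using Cons by auto
qed simp

lemma fst_set_inv_word: "fst ` set (inv_word w) = fst ` set w"
  by (simp add: inv_word_def image_image inv_letter_def)

theorem group_free_group: "group (free_group X)"
proof (rule groupI)
  fix u v
  assume "u \<in> carrier (free_group X)" "v \<in> carrier (free_group X)"
  then show "u \<otimes>\<^bsub>free_group X\<^esub> v \<in> carrier (free_group X)"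
    using image_mono[OF set_reduce[of "u @ v"], of fst]
    by (simp add: free_group_def image_Un) (meson Un_least subset_trans)
next
  fix u
  assume u: "u \<in> carrier (free_group X)"
  then show "\<exists>v\<in>carrier (free_group X). v \<otimes>\<^bsub>free_group X\<^esub> u = \<one>\<^bsub>free_group X\<^esub>"
    by (intro bexI[of _ "inv_word u"])
      (simp_all add: free_group_def reduce_inv_word_append reduced_inv_word fst_set_inv_word)
qed (simp_all add: free_group_def reduce_append_left reduce_append_right reduce_reduced)

lemma inv_free_group:
  assumes "w \<in> carrier (free_group X)"
  shows "inv\<^bsub>free_group X\<^esub> w = inv_word w"
proof (rule group.inv_equality[OF group_free_group])
  show "inv_word w \<otimes>\<^bsub>free_group X\<^esub> w = \<one>\<^bsub>free_group X\<^esub>"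
    by (simp add: free_group_def reduce_inv_word_append)
  show "inv_word w \<in> carrier (free_group X)"
    using assms by (simp add: free_group_def reduced_inv_word fst_set_inv_word)
qed (fact assms)

lemma mult_free_group_cancelled:
  assumes "u \<in> carrier (free_group X)" "v \<in> carrier (free_group X)"
  defines "k \<equiv> cancelled u v"
  shows "u \<otimes>\<^bsub>free_group X\<^esub> v = take (length u - k) u @ drop k v"
proof -
  have red: "reduced u" "reduced v"
    using assms by (simp_all add: free_group_def)
  define c where "c = longest_common_prefix (inv_word u) v"
  obtain u' v' where u': "inv_word u = c @ u'" and v': "v = c @ v'"
    unfolding c_def by (meson longest_common_prefix_prefix1 longest_common_prefix_prefix2 prefixE)
  have u: "u = inv_word u' @ inv_word c"
    using u' by (metis inv_word_simps(3,4))
  have k: "k = length c"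
    by (simp add: k_def cancelled_def c_def)
  have ne: "hd u' \<noteq> hd v'" if "u' \<noteq> []" "v' \<noteq> []"
  proof
    assume "hd u' = hd v'"
    then have "prefix (c @ [hd u']) (inv_word u)" "prefix (c @ [hd u']) v"
      using that by (auto simp: u' v' neq_Nil_conv)
    then have "prefix (c @ [hd u']) c"
      unfolding c_def by (rule longest_common_prefix_max_prefix)
    then show False
      by (auto dest: prefix_length_le)
  qed
  have "reduced (inv_word u' @ v')"
    using red ne unfolding u v' by (cases u') (auto simp: reduced_append reduced_Cons)
  then have "reduce (u @ v) = inv_word u' @ v'"
    unfolding u v'
    by (metis append.assoc append_Nil reduce_append_left reduce_append_right
        reduce_inv_word_append reduce_reduced)
  then show ?thesis
    by (simp add: free_group_def k u v')
qed

end

theory Submission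
  imports Defs
begin

text \<open>
  The proof is a length count. Two consecutive letters of a reduced word \<open>w\<close> are never mutually
  inverse. So when the images under \<open>\<phi>\<close> of the letters of \<open>w\<close> are multiplied, every cancellation
  between neighbouring factors is one that the remnants of both factors survive. The remnants
  therefore stand as disjoint blocks in the reduced word \<open>\<phi> w\<close>, whose length is at least the sum of
  their lengths (\<open>sum_length_remnant_le_length_hom_image\<close>). If \<open>w\<close> is nontrivial, this sum exceeds the
  sum of the lengths of the images under \<open>\<psi>\<close> of the letters of \<open>w\<close>, which bounds the length of
  \<open>\<psi> w\<close> from above (\<open>length_hom_image_le\<close>). Hence \<open>\<phi> w \<noteq> \<psi> w\<close>.

  The point that needs care is that cancellation is controlled only between pairs of generator
  images, whereas in the product a factor meets an already reduced tail. Since a remnant is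
  nonempty, it acts as a barrier: whatever follows it cannot influence the cancellation in front of
  it (\<open>cancelled_append_cong\<close>). So an induction from the right (\<open>hom_image_starts_with_block\<close>)
  keeps the first factor intact up to and including its remnant.

  For a fixed generator, the block spanned by two noncancelling blocks is again noncancelling, so the
  longest one is unique (\<open>longest_noncancelling_block_unique\<close>) and the remnant is well defined.
\<close>

section \<open>Homomorphisms between free groups, letter by letter\<close>

lemma carrier_free_group_iff: "w \<in> carrier (free_group X) \<longleftrightarrow> reduced w \<and> fst ` set w \<subseteq> X"
  by (simp add: free_group_def)

lemma Nil_in_carrier [simp]: "[] \<in> carrier (free_group X)"
  by (simp add: carrier_free_group_iff)

lemma carrier_free_group_Cons:
  "l # w \<in> carrier (free_group X) \<longleftrightarrow>
    fst l \<in> X \<and> (w \<noteq> [] \<longrightarrow> hd w \<noteq> inv_letter l) \<and> w \<in> carrier (free_group X)"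
  by (auto simp: carrier_free_group_iff reduced_Cons)

lemma letter_in_carrier [simp]: "[l] \<in> carrier (free_group X) \<longleftrightarrow> fst l \<in> X"
  by (simp add: carrier_free_group_iff reduced_Cons)

lemma hom_free_group_closed:
  "\<phi> \<in> hom (free_group X) H \<Longrightarrow> w \<in> carrier (free_group X) \<Longrightarrow> \<phi> w \<in> carrier H"
  by (auto simp: hom_def)

lemma group_hom_free_group:
  "\<phi> \<in> hom (free_group X) (free_group B) \<Longrightarrow> group_hom (free_group X) (free_group B) \<phi>"
  by (simp add: group_hom_def group_hom_axioms_def group_free_group)

lemma hom_free_group_Nil:
  assumes "\<phi> \<in> hom (free_group X) (free_group B)"
  shows "\<phi> [] = []"
  using group_hom.hom_one[OF group_hom_free_group[OF assms]] by (simp add: free_group_def)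

lemma hom_free_group_inv_letter:
  assumes "\<phi> \<in> hom (free_group X) (free_group B)" "fst l \<in> X"
  shows "\<phi> [inv_letter l] = inv_word (\<phi> [l])"
proof -
  have l: "[l] \<in> carrier (free_group X)"
    using assms by simp
  have "\<phi> [inv_letter l] = \<phi> (inv\<^bsub>free_group X\<^esub> [l])"
    using inv_free_group[OF l] by simp
  also have "\<dots> = inv\<^bsub>free_group B\<^esub> (\<phi> [l])"
    using group_hom.hom_inv[OF group_hom_free_group[OF assms(1)] l] .
  also have "\<dots> = inv_word (\<phi> [l])"
    by (rule inv_free_group[OF hom_free_group_closed[OF assms(1) l]])
  finally show ?thesis .
qed

lemma hom_free_group_letter:
  assumes "\<phi> \<in> hom (free_group X) (free_group B)" "i \<in> X"
  shows "\<phi> [(i, e)] = signed e (\<phi> (gen i))"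
  using hom_free_group_inv_letter[OF assms(1), of "(i, True)"] assms(2)
  by (cases e) (auto simp: signed_def gen_def inv_letter_def)

lemma hom_free_group_Cons:
  assumes "\<phi> \<in> hom (free_group X) H" "l # w \<in> carrier (free_group X)"
  shows "\<phi> (l # w) = \<phi> [l] \<otimes>\<^bsub>H\<^esub> \<phi> w"
proof -
  have "[l] \<otimes>\<^bsub>free_group X\<^esub> w = l # w"
    using assms(2) reduce_reduced[of "l # w"] by (simp add: free_group_def)
  moreover have "[l] \<in> carrier (free_group X)" "w \<in> carrier (free_group X)"
    using assms(2) by (simp_all add: carrier_free_group_Cons)
  ultimately show ?thesis
    using hom_mult[OF assms(1), of "[l]" w] by simp
qed

lemma length_reduce_le: "length (reduce w) \<le> length w"
proof (induction w)
  case (Cons l w)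
  have "length (push_letter l (reduce w)) \<le> Suc (length (reduce w))"
    by (auto simp: push_letter_def split: list.split)
  with Cons show ?case
    by simp
qed simp

lemma length_signed [simp]: "length (signed e w) = length w"
  by (simp add: signed_def)

lemma length_hom_image_le:
  assumes "\<psi> \<in> hom (free_group X) (free_group B)" "w \<in> carrier (free_group X)"
  shows "length (\<psi> w) \<le> (\<Sum>l\<leftarrow>w. length (\<psi> (gen (fst l))))"
  using assms(2)
proof (induction w)
  case Nil
  show ?case
    by (simp add: hom_free_group_Nil[OF assms(1)])
next
  case (Cons l w)
  have "\<psi> (l # w) = reduce (\<psi> [l] @ \<psi> w)"
    using hom_free_group_Cons[OF assms(1) Cons.prems] by (simp add: free_group_def)
  then have "length (\<psi> (l # w)) \<le> length (\<psi> [l]) + length (\<psi> w)"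
    using length_reduce_le[of "\<psi> [l] @ \<psi> w"] by simp
  moreover have "length (\<psi> [l]) = length (\<psi> (gen (fst l)))"
    using hom_free_group_letter[OF assms(1), of "fst l" "snd l"] Cons.prems
    by (simp add: carrier_free_group_Cons)
  ultimately show ?case
    using Cons by (simp add: carrier_free_group_Cons)
qed

section \<open>Cancellation stops at a surviving letter\<close>

lemma longest_common_prefix_commute: "longest_common_prefix u v = longest_common_prefix v u"
  by (induction u v rule: longest_common_prefix.induct) auto

lemma cancelled_inv_word: "cancelled (inv_word u) (inv_word v) = cancelled v u"
  by (simp add: cancelled_def longest_common_prefix_commute)

lemma longest_common_prefix_append_cong:
  "length (longest_common_prefix u (v @ x)) < length v \<Longrightarrow>
    longest_common_prefix u (v @ y) = longest_common_prefix u (v @ x)"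
proof (induction v arbitrary: u)
  case (Cons a v)
  then show ?case
    by (cases u) auto
qed simp

text \<open>
  If cancellation from the left against \<open>v x\<close> stops strictly inside \<open>v\<close>, the letter of \<open>v\<close> at which
  it stops is unchanged when \<open>x\<close> is replaced.
\<close>

lemma cancelled_append_cong:
  "cancelled u (v @ x) < length v \<Longrightarrow> cancelled u (v @ y) = cancelled u (v @ x)"
  using longest_common_prefix_append_cong[of "inv_word u" v x y] by (simp add: cancelled_def)

section \<open>Noncancelling blocks in the images of signed letters\<close>

text \<open>
  Along a reduced word, generators and their inverses occur on an equal footing. In terms of signed
  letters, the one product that the notion of remnant excludes is the one of \<open>l\<close> with its inverse,
  so the condition below is invariant under inversion (\<open>letter_block_inv\<close>).
\<close>

definition letter_block ::
  "'a set \<Rightarrow> ('a word \<Rightarrow> 'b word) \<Rightarrow> 'a \<times> bool \<Rightarrow> 'b word \<Rightarrow> 'b word \<Rightarrow> 'b word \<Rightarrow> bool" where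
  "letter_block X \<phi> l p r s \<longleftrightarrow>
     \<phi> [l] = p @ r @ s \<and> r \<noteq> [] \<and>
     (\<forall>m. fst m \<in> X \<longrightarrow> m \<noteq> inv_letter l \<longrightarrow>
        cancelled (\<phi> [m]) (\<phi> [l]) \<le> length p \<and> cancelled (\<phi> [l]) (\<phi> [m]) \<le> length s)"

lemma cancelled_letter_block_le:
  assumes "letter_block X \<phi> l p r s" "fst m \<in> X" "m \<noteq> inv_letter l"
  shows "cancelled (\<phi> [m]) (\<phi> [l]) \<le> length p" "cancelled (\<phi> [l]) (\<phi> [m]) \<le> length s"
  using assms unfolding letter_block_def by blast+

lemma letter_block_gen:
  assumes "\<phi> \<in> hom (free_group X) (free_group B)" "noncancelling_block X \<phi> i p r s"
  shows "letter_block X \<phi> (i, True) p r s"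
proof -
  have i: "\<phi> [(i, True)] = \<phi> (gen i)"
    by (simp add: gen_def)
  have "cancelled (\<phi> [m]) (\<phi> (gen i)) \<le> length p \<and> cancelled (\<phi> (gen i)) (\<phi> [m]) \<le> length s"
    if m: "fst m \<in> X" "m \<noteq> inv_letter (i, True)" for m
  proof -
    have "\<not> (fst m = i \<and> \<not> snd m)"
      using m(2) by (auto simp: inv_letter_def prod_eq_iff)
    moreover have "\<phi> [m] = signed (snd m) (\<phi> (gen (fst m)))"
      using hom_free_group_letter[OF assms(1) m(1), of "snd m"] by simp
    ultimately show ?thesis
      using assms(2) m(1) unfolding noncancelling_block_def by metis
  qed
  then show ?thesis
    using assms(2) unfolding letter_block_def noncancelling_block_def i by blast
qed

lemma letter_block_inv:
  assumes \<phi>: "\<phi> \<in> hom (free_group X) (free_group B)" and l: "fst l \<in> X"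
    and block: "letter_block X \<phi> l p r s"
  shows "letter_block X \<phi> (inv_letter l) (inv_word s) (inv_word r) (inv_word p)"
proof -
  have "cancelled (\<phi> [m]) (\<phi> [inv_letter l]) \<le> length s \<and>
      cancelled (\<phi> [inv_letter l]) (\<phi> [m]) \<le> length p"
    if m: "fst m \<in> X" "m \<noteq> l" for m
  proof -
    have "fst (inv_letter m) \<in> X"
      using m(1) by (simp add: inv_letter_def)
    moreover have "inv_letter m \<noteq> inv_letter l"
      using m(2) by simp
    ultimately have "cancelled (\<phi> [inv_letter m]) (\<phi> [l]) \<le> length p"
      "cancelled (\<phi> [l]) (\<phi> [inv_letter m]) \<le> length s"
      using cancelled_letter_block_le[OF block] by blast+
    then show ?thesis
      using cancelled_inv_word[of "\<phi> [m]" "inv_word (\<phi> [l])"]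
        cancelled_inv_word[of "inv_word (\<phi> [l])" "\<phi> [m]"]
      by (simp add: hom_free_group_inv_letter[OF \<phi>] m l)
  qed
  moreover have "inv_word r \<noteq> []"
    using block by (metis inv_word_simps(1,4) letter_block_def)
  ultimately show ?thesis
    using block l by (simp add: letter_block_def hom_free_group_inv_letter[OF \<phi>])
qed

lemma letter_block_exists:
  assumes "\<phi> \<in> hom (free_group X) (free_group B)" "fst l \<in> X"
    and "noncancelling_block X \<phi> (fst l) p\<^sub>0 r\<^sub>0 s\<^sub>0"
  obtains p r s where "letter_block X \<phi> l p r s" "length r = length r\<^sub>0"
proof -
  obtain i e where l: "l = (i, e)"
    by (cases l)
  have gen: "letter_block X \<phi> (i, True) p\<^sub>0 r\<^sub>0 s\<^sub>0"
    using letter_block_gen[OF assms(1)] assms(3) by (simp add: l)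
  have inv: "letter_block X \<phi> (i, False) (inv_word s\<^sub>0) (inv_word r\<^sub>0) (inv_word p\<^sub>0)"
    using letter_block_inv[OF assms(1) _ gen] assms(2) by (simp add: l inv_letter_def)
  show ?thesis
  proof (cases e)
    case True
    then show ?thesis
      using that[OF _ refl] gen by (simp add: l)
  next
    case False
    show ?thesis
      by (rule that[of "inv_word s\<^sub>0" "inv_word r\<^sub>0" "inv_word p\<^sub>0"]) (use inv False in \<open>simp_all add: l\<close>)
  qed
qed

section \<open>The remnant is a noncancelling block\<close>

text \<open>
  The conditions on the two ends of a block are independent, so the shorter left end of one block may
  be combined with the shorter right end of another. If both blocks are longest, the combined one
  cannot be longer, and the ends agree.
\<close>

lemma longest_noncancelling_block_unique:
  assumes block: "noncancelling_block X \<phi> i p r s" and block': "noncancelling_block X \<phi> i p' r' s'"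
    and longest: "\<And>p'' r'' s''. noncancelling_block X \<phi> i p'' r'' s'' \<Longrightarrow> length r'' \<le> length r"
    and eq: "length r' = length r"
  shows "r' = r"
proof -
  define w where "w = \<phi> (gen i)"
  define a b where "a = min (length p) (length p')" and "b = min (length s) (length s')"
  have w: "w = p @ r @ s" and ne: "0 < length r"
    using block by (simp_all add: noncancelling_block_def w_def)
  have w': "w = p' @ r' @ s'"
    using block' by (simp add: noncancelling_block_def w_def)
  have len: "length w = length p + length r + length s"
    "length w = length p' + length r' + length s'"
    using arg_cong[OF w, of length] arg_cong[OF w', of length] by simp_all
  \<comment> \<open>The block that is left after removing the shorter of the two ends on either side.\<close>
  define r'' where "r'' = drop a (take (length w - b) w)"
  have lenr'': "length r'' = length w - b - a"
    by (simp add: r''_def)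
  have ab: "a \<le> length p" "a \<le> length p'" "b \<le> length s" "b \<le> length s'"
    by (simp_all add: a_def b_def)
  have "take a w @ r'' @ drop (length w - b) w = w"
  proof -
    have "take a w = take a (take (length w - b) w)"
      using ab len by (simp add: min_def)
    then show ?thesis
      by (metis append.assoc append_take_drop_id r''_def)
  qed
  moreover have "0 < length r''"
    using lenr'' ab len ne by linarith
  moreover have "length (take a w) = a" "length (drop (length w - b) w) = b"
    using ab len by simp_all
  moreover have "cancelled (signed e (\<phi> (gen j))) (\<phi> (gen i)) \<le> a"
    "cancelled (\<phi> (gen i)) (signed e (\<phi> (gen j))) \<le> b"
    if "j \<in> X" "\<not> (j = i \<and> \<not> e)" for j e
    using block block' that
    unfolding noncancelling_block_def a_def b_def min.bounded_iff by blast+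
  ultimately have "noncancelling_block X \<phi> i (take a w) r'' (drop (length w - b) w)"
    by (simp add: noncancelling_block_def w_def)
  then have "length w - b - a \<le> length r"
    using longest lenr'' by metis
  then have "length p = length p'"
    using ab len eq by linarith
  then show ?thesis
    using w w' eq by simp
qed

lemma noncancelling_block_remnant:
  assumes "noncancelling_block X \<phi> i p\<^sub>0 r\<^sub>0 s\<^sub>0"
  obtains p s where "noncancelling_block X \<phi> i p (remnant X \<phi> i) s"
proof -
  let ?Q = "\<lambda>r. \<exists>p s. noncancelling_block X \<phi> i p r s"
  let ?R = "\<lambda>r. \<exists>p s. noncancelling_block X \<phi> i p r s \<and>
     (\<forall>p' r' s'. noncancelling_block X \<phi> i p' r' s' \<longrightarrow> length r' \<le> length r)"
  have "\<forall>r. ?Q r \<longrightarrow> length r < Suc (length (\<phi> (gen i)))"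
    by (auto simp: noncancelling_block_def)
  then obtain r where r: "?Q r" "\<And>r'. ?Q r' \<Longrightarrow> length r' \<le> length r"
    using ex_has_greatest_nat[of ?Q r\<^sub>0 length] assms by blast
  then obtain p s where block: "noncancelling_block X \<phi> i p r s"
    by blast
  have longest: "length r' \<le> length r" if "noncancelling_block X \<phi> i p' r' s'" for p' r' s'
    using that r(2) by blast
  have "?R (THE r. ?R r)"
  proof (rule theI)
    show "?R r"
      using block longest by blast
  next
    fix r' assume "?R r'"
    then obtain p' s' where "noncancelling_block X \<phi> i p' r' s'" "length r \<le> length r'"
      using block by blast
    then show "r' = r"
      using longest_noncancelling_block_unique[OF block _ longest] longest by (simp add: le_antisym)
  qed
  then show ?thesis
    using that unfolding remnant_def by blast
qed

section \<open>Remnants survive in the image of a reduced word\<close>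

text \<open>
  The conclusion keeps the prefix \<open>p r\<close> of the first factor literally, which is stronger than the
  length bound: the next factor on the left then meets the same letters as in the product of two
  letter images, up to the barrier \<open>r\<close>.
\<close>

lemma hom_image_starts_with_block:
  assumes \<phi>: "\<phi> \<in> hom (free_group X) (free_group B)"
    and blocks: "\<And>l. fst l \<in> X \<Longrightarrow> \<exists>p r s. letter_block X \<phi> l p r s \<and> length r = N (fst l)"
    and "l # w \<in> carrier (free_group X)" "letter_block X \<phi> l p r s"
  shows "\<exists>t. \<phi> (l # w) = p @ r @ t \<and> (\<Sum>m\<leftarrow>w. N (fst m)) \<le> length t"
  using assms(3,4)
proof (induction w arbitrary: l p r s)
  case Nil
  then show ?case
    by (simp add: letter_block_def)
next
  case (Cons m w)
  have l: "fst l \<in> X" and m: "fst m \<in> X" "m \<noteq> inv_letter l" "m # w \<in> carrier (free_group X)"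
    using Cons.prems(1) by (simp_all add: carrier_free_group_Cons)
  obtain p' r' s' where block': "letter_block X \<phi> m p' r' s'" and N: "length r' = N (fst m)"
    using blocks[OF m(1)] by blast
  obtain t where t: "\<phi> (m # w) = p' @ r' @ t" and len_t: "(\<Sum>m\<leftarrow>w. N (fst m)) \<le> length t"
    using Cons.IH[OF m(3) block'] by blast
  define k where "k = cancelled (\<phi> [l]) (\<phi> (m # w))"
  have "l \<noteq> inv_letter m"
    using m(2) by auto
  then have le_p': "cancelled (\<phi> [l]) (\<phi> [m]) \<le> length p'"
    using cancelled_letter_block_le(1)[OF block'] l by blast
  have le_s: "cancelled (\<phi> [l]) (\<phi> [m]) \<le> length s"
    using cancelled_letter_block_le(2)[OF Cons.prems(2)] m(1,2) by blast
  have \<phi>m: "\<phi> [m] = (p' @ r') @ s'" and "r' \<noteq> []"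
    using block' by (simp_all add: letter_block_def)
  then have "cancelled (\<phi> [l]) ((p' @ r') @ s') < length (p' @ r')"
    using le_p' by (simp add: le_less_trans)
  \<comment> \<open>The letters after \<open>p' r'\<close> differ in \<open>\<phi> [m]\<close> and \<open>\<phi> (m # w)\<close>, but no cancellation gets past
    the nonempty \<open>r'\<close>.\<close>
  then have k: "k = cancelled (\<phi> [l]) (\<phi> [m])"
    unfolding k_def t \<phi>m append.assoc[symmetric] by (rule cancelled_append_cong)
  have \<phi>l: "\<phi> [l] = p @ r @ s"
    using Cons.prems(2) by (simp add: letter_block_def)
  have "\<phi> (l # m # w) = \<phi> [l] \<otimes>\<^bsub>free_group B\<^esub> \<phi> (m # w)"
    by (rule hom_free_group_Cons[OF \<phi> Cons.prems(1)])
  also have "\<dots> = take (length (\<phi> [l]) - k) (\<phi> [l]) @ drop k (\<phi> (m # w))"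
    unfolding k_def
    by (rule mult_free_group_cancelled) (use hom_free_group_closed[OF \<phi>] l m(3) in simp_all)
  also have "\<dots> = p @ r @ take (length s - k) s @ drop k p' @ r' @ t"
    using le_s le_p' by (simp add: \<phi>l t k)
  finally have "\<phi> (l # m # w) = p @ r @ take (length s - k) s @ drop k p' @ r' @ t" .
  then show ?case
    using len_t N by auto
qed

lemma sum_length_remnant_le_length_hom_image:
  assumes \<phi>: "\<phi> \<in> hom (free_group X) (free_group B)" and rem: "has_remnant X \<phi>"
    and w: "w \<in> carrier (free_group X)"
  shows "(\<Sum>l\<leftarrow>w. length (remnant X \<phi> (fst l))) \<le> length (\<phi> w)"
proof (cases w)
  case (Cons l v)
  let ?N = "\<lambda>i. length (remnant X \<phi> i)"
  have blocks: "\<exists>p r s. letter_block X \<phi> m p r s \<and> length r = ?N (fst m)" if m: "fst m \<in> X" for m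
  proof -
    obtain p s where "noncancelling_block X \<phi> (fst m) p (remnant X \<phi> (fst m)) s"
      using rem m unfolding has_remnant_def by (metis noncancelling_block_remnant)
    then show ?thesis
      by (metis letter_block_exists[OF \<phi> m])
  qed
  have "fst l \<in> X"
    using w by (simp add: Cons carrier_free_group_Cons)
  then obtain p r s where block: "letter_block X \<phi> l p r s" "length r = ?N (fst l)"
    using blocks by blast
  show ?thesis
    using hom_image_starts_with_block[OF \<phi> blocks _ block(1), of v] w block(2)
    by (auto simp: Cons)
qed simp

theorem corollary3p14:
  fixes n :: nat and B :: "'b set"
    and \<phi> \<psi> :: "nat word \<Rightarrow> 'b word"
  assumes "finite B"
    and "\<phi> \<in> hom (free_group {1..n}) (free_group B)"
    and "\<psi> \<in> hom (free_group {1..n}) (free_group B)"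
    and "has_remnant {1..n} \<phi>"
    and "\<forall>i\<in>{1..n}. length (remnant {1..n} \<phi> i) > length (\<psi> (gen i))"
  shows "equalizer (free_group {1..n}) \<phi> \<psi> = {\<one>\<^bsub>free_group {1..n}\<^esub>}"
proof -
  let ?G = "free_group {1..n}"
  have "w = []" if w: "w \<in> carrier ?G" and eq: "\<phi> w = \<psi> w" for w
  proof (rule ccontr)
    assume "w \<noteq> []"
    have "length (\<psi> w) \<le> (\<Sum>l\<leftarrow>w. length (\<psi> (gen (fst l))))"
      by (rule length_hom_image_le[OF assms(3) w])
    also have "\<dots> < (\<Sum>l\<leftarrow>w. length (remnant {1..n} \<phi> (fst l)))"
    proof (rule sum_list_strict_mono[OF \<open>w \<noteq> []\<close>])
      fix l assume "l \<in> set w"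
      then have "fst l \<in> {1..n}"
        using w by (auto simp: carrier_free_group_iff)
      then show "length (\<psi> (gen (fst l))) < length (remnant {1..n} \<phi> (fst l))"
        using assms(5) by blast
    qed
    also have "\<dots> \<le> length (\<phi> w)"
      by (rule sum_length_remnant_le_length_hom_image[OF assms(2,4) w])
    finally show False
      using eq by simp
  qed
  moreover have "[] \<in> carrier ?G" "\<phi> [] = \<psi> []"
    using assms(2,3) by (simp_all add: carrier_free_group_iff hom_free_group_Nil)
  ultimately show ?thesis
    unfolding equalizer_def by (auto simp: free_group_def)
qed

end
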